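(* Let $\alpha,\beta_0,\beta_1,d$ be positive integers and let $r$ be a nonnegative integer. Let $$\sigma=\frac{\beta_0-\alpha}{\beta_1}+\frac{L_d(\alpha)}{\beta_1F_d(\alpha)},\qquad \rho=\frac{(-1)^{d-1}}{\beta_1^2F_d(\alpha)^2}.$$ Then the value of the infinite continued fraction $$\xi(\alpha,\beta_0,\beta_1,d,r)=[\underbrace{\alpha,\ldots,\alpha}_r,\beta_0,\overline{\underbrace{\alpha,\ldots,\alpha,\beta_0+\beta_1\cdot n}_d}]_{n=1}^\infty$$ is given by $$\xi(\alpha,\beta_0,\beta_1,d,r)=\frac{F_{r+1}(\alpha)I_{\sigma-1}(2\sqrt{\rho})+(-1)^{r+1}F_{d-r-1}(\alpha)I_{\sigma}(2\sqrt{\rho})}{F_{r}(\alpha)I_{\sigma-1}(2\sqrt{\rho})+(-1)^{r}F_{d-r}(\alpha)I_{\sigma}(2\sqrt{\rho})}$$ if $d$ is odd, and by $$\xi(\alpha,\beta_0,\beta_1,d,r)=\frac{F_{r+1}(\alpha)J_{\sigma-1}(2\sqrt{-\rho})+(-1)^{r+1}F_{d-r-1}(\alpha)J_{\sigma}(2\sqrt{-\rho})}{F_{r}(\alpha)J_{\sigma-1}(2\sqrt{-\rho})+(-1)^{r}F_{d-r}(\alpha)J_{\sigma}(2\sqrt{-\rho})}$$ if $d$ is even.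
   Context: Continued fraction: $\xi(\alpha,\beta_0,\beta_1,d,r)=[a_0,a_1,a_2,\ldots]$ is the infinite simple continued fraction with $a_{r+jd}=\beta_0+\beta_1 j$ for all integers $j\ge 0$ and $a_i=\alpha$ for every other index $i\ge 0$; its value is the limit of the finite continued fractions $[a_0,\ldots,a_m]$ as $m\to\infty$. Fibonacci and Lucas polynomials: $F_0(q)=0$, $F_1(q)=1$, $L_0(q)=2$, $L_1(q)=q$, and $X_n(q)=qX_{n-1}(q)+X_{n-2}(q)$ for $X\in\{F,L\}$. The sequence $F_n$ is extended to negative indices by the same recurrence (equivalently $F_{-n}(q)=(-1)^{n+1}F_n(q)$). Bessel functions of the first kind, modified and ordinary (used here for $z>0$): $$I_\nu(z)=\sum_{m=0}^\infty\frac{(z/2)^{\nu+2m}}{\Gamma(m+1)\Gamma(\nu+m+1)},\qquad J_\nu(z)=\sum_{m=0}^\infty\frac{(-1)^m(z/2)^{\nu+2m}}{\Gamma(m+1)\Gamma(\nu+m+1)}.$$ *)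

theory Defs
  imports "HOL-Analysis.Analysis" "HOL-Computational_Algebra.Polynomial"
begin

fun fib_poly_nat :: "nat \<Rightarrow> real poly" where
  "fib_poly_nat 0 = 0"
| "fib_poly_nat (Suc 0) = 1"
| "fib_poly_nat (Suc (Suc n)) = [:0, 1:] * fib_poly_nat (Suc n) + fib_poly_nat n"

text \<open>The negative indices are those forced by running the recurrence backwards; this is what
  \<open>fib_poly_rec\<close> below confirms, for every integer index.\<close>

definition fib_poly :: "int \<Rightarrow> real poly" where
  "fib_poly n = (if 0 \<le> n then fib_poly_nat (nat n)
                 else (-1) ^ (nat (- n) + 1) * fib_poly_nat (nat (- n)))"

lemma fib_poly_rec: "fib_poly n = [:0, 1:] * fib_poly (n - 1) + fib_poly (n - 2)"
proof -
  consider "n \<ge> 2" | "n = 1" | "n = 0" | "n \<le> -1" by linarith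
  then show ?thesis
  proof cases
    case 1
    define k where "k = nat (n - 2)"
    have "nat n = Suc (Suc k)" "nat (n - 1) = Suc k" "nat (n - 2) = k"
      using 1 by (auto simp: k_def)
    with 1 show ?thesis by (simp add: fib_poly_def)
  next
    case 4
    define k where "k = nat (- n)"
    have "nat (- n) = k" "nat (- (n - 1)) = Suc k" "nat (- (n - 2)) = Suc (Suc k)"
      using 4 by (auto simp: k_def)
    with 4 show ?thesis by (simp add: fib_poly_def algebra_simps)
  qed (simp_all add: fib_poly_def numeral_2_eq_2)
qed

fun lucas_poly :: "nat \<Rightarrow> real poly" where
  "lucas_poly 0 = 2"
| "lucas_poly (Suc 0) = [:0, 1:]"
| "lucas_poly (Suc (Suc n)) = [:0, 1:] * lucas_poly (Suc n) + lucas_poly n"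

text \<open>The Bessel functions are meant for \<open>z > 0\<close>. Since \<open>Gamma\<close> is 0 at its poles and
  \<open>x / 0 = 0\<close>, a term whose Gamma factor has a pole vanishes, as in the usual convention.\<close>

definition bessel_I :: "real \<Rightarrow> real \<Rightarrow> real" where
  "bessel_I \<nu> z =
     (\<Sum>m. (z / 2) powr (\<nu> + 2 * real m) / (Gamma (real m + 1) * Gamma (\<nu> + real m + 1)))"

definition bessel_J :: "real \<Rightarrow> real \<Rightarrow> real" where
  "bessel_J \<nu> z =
     (\<Sum>m. (-1) ^ m * (z / 2) powr (\<nu> + 2 * real m)
            / (Gamma (real m + 1) * Gamma (\<nu> + real m + 1)))"

text \<open>\<open>finite_cfrac a m\<close> is the finite continued fraction $[a_0, \ldots, a_m]$.\<close>

fun finite_cfrac :: "(nat \<Rightarrow> nat) \<Rightarrow> nat \<Rightarrow> real" where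
  "finite_cfrac a 0 = real (a 0)"
| "finite_cfrac a (Suc m) = real (a 0) + 1 / finite_cfrac (\<lambda>i. a (Suc i)) m"

definition xi_quot :: "nat \<Rightarrow> nat \<Rightarrow> nat \<Rightarrow> nat \<Rightarrow> nat \<Rightarrow> nat \<Rightarrow> nat" where
  "xi_quot \<alpha> \<beta>0 \<beta>1 d r i =
     (if r \<le> i \<and> d dvd (i - r) then \<beta>0 + \<beta>1 * ((i - r) div d) else \<alpha>)"

definition xi :: "nat \<Rightarrow> nat \<Rightarrow> nat \<Rightarrow> nat \<Rightarrow> nat \<Rightarrow> real" where
  "xi \<alpha> \<beta>0 \<beta>1 d r = lim (finite_cfrac (xi_quot \<alpha> \<beta>0 \<beta>1 d r))"

end

theory Submission
  imports Defs
begin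

text \<open>Both Bessel functions at the relevant argument are \<open>s powr \<nu>\<close> times one entire series in
  \<open>\<rho>\<close>, where \<open>s\<^sup>2 = \<bar>\<rho>\<bar>\<close>; this treats odd and even \<open>d\<close> together. Their contiguous relation
  is exactly what is needed to glue Fibonacci combinations of consecutive Bessel values into a
  solution of \<open>y\<^sub>n = a\<^sub>n y\<^sub>n\<^sub>+\<^sub>1 + y\<^sub>n\<^sub>+\<^sub>2\<close>. The solution is bounded and nonzero, so the
  continued fraction converges to \<open>y\<^sub>0 / y\<^sub>1\<close>. No positivity of the \<open>y\<^sub>n\<close>, hence no
  information on zeros of \<open>J\<close>, is required.\<close>

section \<open>Convergents and three-term recurrences\<close>

lemma finite_cfrac_ge_1:
  assumes "\<And>i. a i \<ge> 1"
  shows "finite_cfrac a m \<ge> 1"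
  using assms
proof (induction m arbitrary: a)
  case 0
  then show ?case using 0[of 0] by simp
next
  case (Suc m)
  have "finite_cfrac (\<lambda>i. a (Suc i)) m \<ge> 1"
    using Suc.prems by (intro Suc.IH)
  moreover have "real (a 0) \<ge> 1"
    using Suc.prems[of 0] by simp
  ultimately show ?case
    by (simp add: add_increasing2)
qed

text \<open>Peeling off two quotients turns the error into that of the tail \<open>u\<close>,
  divided by \<open>a 1 * u + 1\<close>, which is at least 2. One quotient alone only guarantees
  that the error does not grow, so the induction goes in steps of two and the exponent is
  \<open>m div 2\<close>.\<close>

lemma finite_cfrac_error:
  fixes y :: "nat \<Rightarrow> real"
  assumes "\<And>i. a i \<ge> 1" and "\<And>n. y n = real (a n) * y (Suc n) + y (Suc (Suc n))"
  shows "\<bar>y 0 - finite_cfrac a m * y 1\<bar> \<le> \<bar>y (m + 2)\<bar> / 2 ^ (m div 2)"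
  using assms
proof (induction m arbitrary: a y rule: induct_nat_012)
  case 0
  show ?case using 0(2)[of 0] by simp
next
  case 1
  have a1: "real (a 1) \<ge> 1" using 1(1)[of 1] by simp
  have "y 0 - finite_cfrac a (Suc 0) * y 1 = - (y 3 / real (a 1))"
    using 1(2)[of 0] 1(2)[of 1] a1 by (simp add: field_simps numeral_3_eq_3)
  then have "\<bar>y 0 - finite_cfrac a (Suc 0) * y 1\<bar> = \<bar>y 3\<bar> / real (a 1)"
    using a1 by simp
  also have "\<dots> \<le> \<bar>y 3\<bar> / 1"
    using a1 by (intro divide_left_mono) auto
  finally show ?case by (simp add: numeral_3_eq_3)
next
  case (ge2 m)
  define b where "b = (\<lambda>i. a (Suc (Suc i)))"
  define z where "z = (\<lambda>i. y (Suc (Suc i)))"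
  define u where "u = finite_cfrac b m"
  have IH: "\<bar>z 0 - u * z 1\<bar> \<le> \<bar>z (m + 2)\<bar> / 2 ^ (m div 2)"
    unfolding u_def
    by (rule ge2.IH(1)) (unfold b_def z_def, (rule ge2.prems)+)
  have u: "u \<ge> 1"
    unfolding u_def b_def by (intro finite_cfrac_ge_1 ge2.prems)
  have a1: "real (a 1) \<ge> 1" using ge2.prems(1)[of 1] by simp
  have pos: "real (a 1) * u + 1 \<ge> 2"
    using mult_mono[OF a1 u] u by simp
  have c: "finite_cfrac a (Suc (Suc m)) = real (a 0) + 1 / (real (a 1) + 1 / u)"
    by (simp add: u_def b_def)
  have ne: "real (a 1) + 1 / u > 0" "u > 0" using a1 u by (auto intro: add_pos_pos)
  have c': "finite_cfrac a (Suc (Suc m)) = real (a 0) + u / (real (a 1) * u + 1)"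
    unfolding c using ne by (simp add: field_simps)
  have "(y 0 - finite_cfrac a (Suc (Suc m)) * y 1) * (real (a 1) * u + 1)
      = (y 0 - real (a 0) * y 1) * (real (a 1) * u + 1) - u * y 1"
    using pos unfolding c' by (simp add: field_simps)
  \<comment> \<open>\<open>y 0 - a 0 * y 1\<close> is \<open>y 2\<close>; inserting
    \<open>y 1 = a 1 * y 2 + y 3\<close> cancels the term \<open>a 1 * u * y 2\<close>.\<close>
  also have "\<dots> = z 0 - u * z 1"
    using ge2.prems(2)[of 0] ge2.prems(2)[of 1]
    by (simp add: z_def algebra_simps numeral_2_eq_2 numeral_3_eq_3)
  finally have "y 0 - finite_cfrac a (Suc (Suc m)) * y 1
      = (z 0 - u * z 1) / (real (a 1) * u + 1)"
    using pos by (intro eq_divide_imp; linarith)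
  then have "\<bar>y 0 - finite_cfrac a (Suc (Suc m)) * y 1\<bar>
      = \<bar>z 0 - u * z 1\<bar> / (real (a 1) * u + 1)"
    using pos by (simp add: abs_divide del: finite_cfrac.simps)
  also have "\<dots> \<le> (\<bar>z (m + 2)\<bar> / 2 ^ (m div 2)) / 2"
    using pos IH by (intro frac_le) auto
  finally show ?case by (simp add: z_def)
qed

text \<open>Pincherle's theorem in the form needed here: a bounded solution of the three-term
  recurrence is minimal because the denominators of the convergents grow exponentially.\<close>

lemma finite_cfrac_tendsto:
  fixes y :: "nat \<Rightarrow> real"
  assumes a: "\<And>i. a i \<ge> 1" and y: "\<And>n. y n = real (a n) * y (Suc n) + y (Suc (Suc n))"
    and bd: "\<And>n. n > N \<Longrightarrow> \<bar>y n\<bar> \<le> M" and nz: "y k \<noteq> 0"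
  shows "finite_cfrac a \<longlonglongrightarrow> y 0 / y 1"
proof -
  have lim: "(\<lambda>m. y 0 - finite_cfrac a m * y 1) \<longlonglongrightarrow> 0"
  proof (rule Lim_null_comparison)
    have "\<bar>y 0 - finite_cfrac a m * y 1\<bar> \<le> M / 2 ^ (m div 2)" if "m > N" for m
      using finite_cfrac_error[where a = a and y = y and m = m, OF a y] bd[of "m + 2"] that
      by (meson divide_right_mono order_trans trans_less_add1 zero_le_numeral zero_le_power)
    then show "\<forall>\<^sub>F m in sequentially. norm (y 0 - finite_cfrac a m * y 1) \<le> M / 2 ^ (m div 2)"
      unfolding real_norm_def by (intro eventually_mono[OF eventually_gt_at_top[of N]])
    have "filterlim (\<lambda>m::nat. m div 2) sequentially sequentially"
      unfolding filterlim_at_top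
    proof safe
      fix Z :: nat
      show "\<forall>\<^sub>F m in sequentially. Z \<le> m div 2"
        by (rule eventually_mono[OF eventually_ge_at_top[of "2 * Z"]]) auto
    qed
    then have "(\<lambda>m. (1 / 2 :: real) ^ (m div 2)) \<longlonglongrightarrow> 0"
      by (rule filterlim_compose[rotated]) (rule LIMSEQ_power_zero, simp)
    then have "(\<lambda>m. M * (1 / 2) ^ (m div 2)) \<longlonglongrightarrow> M * 0"
      by (intro tendsto_mult tendsto_const)
    then show "(\<lambda>m. M / 2 ^ (m div 2)) \<longlonglongrightarrow> 0"
      by (simp add: power_divide)
  qed
  \<comment> \<open>With \<open>y 1 = 0\<close> the limit would force \<open>y 0 = 0\<close>, and
    the recurrence would then annihilate every term; one nonzero term anywhere excludes
    this.\<close>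
  have y1: "y 1 \<noteq> 0"
  proof
    assume "y 1 = 0"
    with lim have "y 0 = 0"
      by (simp add: LIMSEQ_const_iff)
    have "y n = 0 \<and> y (Suc n) = 0" for n
    proof (induction n)
      case (Suc n)
      with y[of n] have "y (Suc (Suc n)) = 0" by algebra
      with Suc show ?case by simp
    qed (use \<open>y 1 = 0\<close> \<open>y 0 = 0\<close> in auto)
    with nz show False by blast
  qed
  have "(\<lambda>m. (y 0 - (y 0 - finite_cfrac a m * y 1)) / y 1) \<longlonglongrightarrow> (y 0 - 0) / y 1"
    by (intro tendsto_intros lim y1)
  with y1 show ?thesis by simp
qed

section \<open>The entire series behind the Bessel functions\<close>

text \<open>The regularised hypergeometric function 0F1(; \<nu> + 1; x). Using
  \<open>rGamma\<close>, which vanishes at the poles of Gamma, leaves no exceptional orders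
  \<nu>.\<close>

definition bessel_series :: "real \<Rightarrow> real \<Rightarrow> real" where
  "bessel_series \<nu> x = (\<Sum>m. x ^ m / fact m * rGamma (\<nu> + real m + 1))"

lemma rGamma_real_nonneg: "x > 0 \<Longrightarrow> rGamma (x :: real) \<ge> 0"
  by (simp add: rGamma_inverse_Gamma)

text \<open>By \<open>rGamma x = x * rGamma (x + 1)\<close> each unit step divides by a factor of at
  least 1. All termwise comparisons of series below rest on this.\<close>

lemma rGamma_plus_nat_le:
  fixes x :: real
  assumes "x \<ge> 1"
  shows "rGamma (x + real m) \<le> rGamma x"
proof (induction m)
  case (Suc m)
  have "rGamma (x + real (Suc m)) \<le> (x + real m) * rGamma (x + real m + 1)"
    using assms mult_right_mono[of 1 "x + real m" "rGamma (x + real m + 1)"]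
    by (simp add: rGamma_real_nonneg algebra_simps)
  also have "\<dots> = rGamma (x + real m)"
    by (rule rGamma_plus1)
  finally show ?case using Suc by simp
qed simp

lemma summable_bessel_series: "summable (\<lambda>m. x ^ m / fact m * rGamma (\<nu> + real m + 1))"
proof (rule summable_comparison_test_ev)
  \<comment> \<open>The order may be negative, as \<sigma> - 1 can be. From the index
    \<open>k\<close> on the argument of \<open>rGamma\<close> is at least 1, so the exponential
    series dominates.\<close>
  define k where "k = nat \<lceil>\<bar>\<nu>\<bar>\<rceil>"
  have k: "\<nu> + real k \<ge> 0" unfolding k_def by linarith
  show "summable (\<lambda>m. \<bar>x\<bar> ^ m / fact m * rGamma (\<nu> + real k + 1))"
    using summable_mult2[OF summable_exp[of "\<bar>x\<bar>"], of "rGamma (\<nu> + real k + 1)"]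
    by (simp add: field_simps)
  have "norm (x ^ m / fact m * rGamma (\<nu> + real m + 1))
      \<le> \<bar>x\<bar> ^ m / fact m * rGamma (\<nu> + real k + 1)" if "m \<ge> k" for m
  proof -
    have "rGamma (\<nu> + real m + 1) \<le> rGamma (\<nu> + real k + 1)"
      using rGamma_plus_nat_le[of "\<nu> + real k + 1" "m - k"] k that
      by (simp add: of_nat_diff algebra_simps)
    moreover have "rGamma (\<nu> + real m + 1) \<ge> 0"
      using k that by (intro rGamma_real_nonneg) linarith
    ultimately show ?thesis
      by (simp add: abs_mult power_abs) (intro divide_right_mono mult_left_mono; simp)
  qed
  then show "\<forall>\<^sub>F m in sequentially. norm (x ^ m / fact m * rGamma (\<nu> + real m + 1))
      \<le> \<bar>x\<bar> ^ m / fact m * rGamma (\<nu> + real k + 1)"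
    using eventually_ge_at_top by (rule eventually_mono[rotated])
qed

text \<open>Split \<open>rGamma (\<nu> + m)\<close> as
  \<open>(\<nu> + m) * rGamma (\<nu> + m + 1)\<close>: the part with \<nu> keeps the order, while
  the factor \<open>m\<close> cancels against the factorial and shifts the index. Depending on the
  sign of \<open>x\<close> this is the contiguous relation of I or of J.\<close>

lemma bessel_series_rec:
  "bessel_series (\<nu> - 1) x = \<nu> * bessel_series \<nu> x + x * bessel_series (\<nu> + 1) x"
proof -
  let ?f = "\<lambda>\<nu> m. x ^ m / fact m * rGamma (\<nu> + real m + 1)"
  have split: "?f (\<nu> - 1) m = \<nu> * ?f \<nu> m + real m * ?f \<nu> m" for m
  proof -
    have "?f (\<nu> - 1) m = x ^ m / fact m * ((\<nu> + real m) * rGamma (\<nu> + real m + 1))"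
      by (simp add: rGamma_plus1)
    then show ?thesis by (simp add: algebra_simps add_divide_distrib)
  qed
  have shift: "real (Suc m) * ?f \<nu> (Suc m) = x * ?f (\<nu> + 1) m" for m
    by (simp add: field_simps del: of_nat_Suc) (simp add: algebra_simps)
  have s: "(\<lambda>m. x * ?f (\<nu> + 1) m) sums (x * bessel_series (\<nu> + 1) x)"
    unfolding bessel_series_def by (intro sums_mult summable_sums summable_bessel_series)
  have "(\<lambda>m. real m * ?f \<nu> m) sums (x * bessel_series (\<nu> + 1) x)"
    using sums_Suc[of "\<lambda>m. real m * ?f \<nu> m", unfolded shift, OF s] by simp
  moreover have "(\<lambda>m. \<nu> * ?f \<nu> m) sums (\<nu> * bessel_series \<nu> x)"
    unfolding bessel_series_def by (intro sums_mult summable_sums summable_bessel_series)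
  ultimately have "(\<lambda>m. ?f (\<nu> - 1) m) sums (\<nu> * bessel_series \<nu> x + x * bessel_series (\<nu> + 1) x)"
    unfolding split by (rule sums_add[rotated])
  then show ?thesis
    unfolding bessel_series_def[of "\<nu> - 1"] by (simp add: sums_iff)
qed

text \<open>Supplies a bound uniform in \<open>j\<close>, the boundedness that makes the solution
  minimal.\<close>

lemma abs_bessel_series_le:
  assumes "\<nu> \<ge> 0"
  shows "\<bar>bessel_series (\<nu> + real j) x\<bar> \<le> bessel_series \<nu> \<bar>x\<bar>"
proof -
  have "norm (x ^ m / fact m * rGamma (\<nu> + real j + real m + 1))
      \<le> \<bar>x\<bar> ^ m / fact m * rGamma (\<nu> + real m + 1)" for m
  proof -
    have "rGamma (\<nu> + real j + real m + 1) \<le> rGamma (\<nu> + real m + 1)"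
      using rGamma_plus_nat_le[of "\<nu> + real m + 1" j] assms by (simp add: algebra_simps)
    moreover have "rGamma (\<nu> + real j + real m + 1) \<ge> 0"
      using assms by (intro rGamma_real_nonneg) linarith
    ultimately show ?thesis
      by (simp add: abs_mult power_abs) (intro divide_right_mono mult_left_mono; simp)
  qed
  then show ?thesis
    unfolding bessel_series_def real_norm_def[symmetric]
    by (intro norm_suminf_le summable_bessel_series)
qed

text \<open>For large order the term at 0, which is \<open>(\<nu> + 1) * rGamma (\<nu> + 2)\<close>,
  outweighs all the others, whose sum is at most
  \<open>(exp \<bar>x\<bar> - 1) * rGamma (\<nu> + 2)\<close> in absolute value.\<close>

lemma bessel_series_nonzero:
  assumes "\<nu> \<ge> exp \<bar>x\<bar>"
  shows "bessel_series \<nu> x \<noteq> 0"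
proof -
  let ?f = "\<lambda>m. x ^ m / fact m * rGamma (\<nu> + real m + 1)"
  let ?g = "\<lambda>m. \<bar>x\<bar> ^ m / fact m * rGamma (\<nu> + 2)"
  have \<nu>: "\<nu> > 0" using assms exp_gt_zero[of "\<bar>x\<bar>"] by linarith
  have g: "?g sums (exp \<bar>x\<bar> * rGamma (\<nu> + 2))"
    using exp_converges[of "\<bar>x\<bar>"] by (intro sums_mult2) (simp add: divide_inverse mult.commute)
  have pos: "rGamma (\<nu> + 1) > 0" "rGamma (\<nu> + 2) > 0"
    using \<nu> by (auto simp: rGamma_inverse_Gamma)
  have "(\<Sum>m. ?g (Suc m)) = exp \<bar>x\<bar> * rGamma (\<nu> + 2) - rGamma (\<nu> + 2)"
    using g by (subst suminf_split_head) (auto simp: sums_iff)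
  moreover have "norm (\<Sum>m. ?f (Suc m)) \<le> (\<Sum>m. ?g (Suc m))"
  proof (rule norm_suminf_le)
    fix m
    have "rGamma (\<nu> + real (Suc m) + 1) \<le> rGamma (\<nu> + 2)"
      using rGamma_plus_nat_le[of "\<nu> + 2" m] \<nu> by (simp add: algebra_simps)
    moreover have "rGamma (\<nu> + real (Suc m) + 1) \<ge> 0"
      using \<nu> by (intro rGamma_real_nonneg) linarith
    ultimately show "norm (?f (Suc m)) \<le> ?g (Suc m)"
      unfolding real_norm_def abs_mult abs_divide power_abs
      by (intro mult_mono) (auto simp del: of_nat_Suc power_Suc)
  next
    show "summable (\<lambda>m. ?g (Suc m))"
      using g by (subst summable_Suc_iff) (auto simp: sums_iff)
  qed
  moreover have "(\<Sum>m. ?f (Suc m)) = bessel_series \<nu> x - rGamma (\<nu> + 1)"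
    unfolding bessel_series_def using suminf_split_head[OF summable_bessel_series[of x \<nu>]] by simp
  moreover have "exp \<bar>x\<bar> * rGamma (\<nu> + 2) \<le> (\<nu> + 1) * rGamma (\<nu> + 2)"
    using assms pos by (intro mult_right_mono) auto
  moreover have "(\<nu> + 1) * rGamma (\<nu> + 2) = rGamma (\<nu> + 1)"
    using rGamma_plus1[of "\<nu> + 1"] by (simp add: add.assoc)
  ultimately show ?thesis using pos by force
qed

lemma bessel_term:
  assumes "s > 0"
  shows "s powr (\<nu> + 2 * real m) / (Gamma (real m + 1) * Gamma (\<nu> + real m + 1))
    = s powr \<nu> * ((s\<^sup>2) ^ m / fact m * rGamma (\<nu> + real m + 1))"
proof -
  have "s powr (2 * real m) = (s\<^sup>2) ^ m"
    using powr_realpow[OF assms, of "2 * m"] by (simp add: power_mult)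
  moreover have "Gamma (real m + 1) = fact m"
    by (metis Gamma_fact add.commute)
  ultimately show ?thesis
    by (simp add: powr_add rGamma_inverse_Gamma divide_inverse)
qed

lemma bessel_I_eq:
  assumes "s > 0"
  shows "bessel_I \<nu> (2 * s) = s powr \<nu> * bessel_series \<nu> (s\<^sup>2)"
  unfolding bessel_I_def bessel_series_def
  by (subst suminf_mult[symmetric, OF summable_bessel_series]) (simp add: bessel_term[OF assms])

lemma bessel_J_eq:
  assumes "s > 0"
  shows "bessel_J \<nu> (2 * s) = s powr \<nu> * bessel_series \<nu> (- s\<^sup>2)"
proof -
  have "(-1) ^ m * (2 * s / 2) powr (\<nu> + 2 * real m)
        / (Gamma (real m + 1) * Gamma (\<nu> + real m + 1))
      = s powr \<nu> * ((- s\<^sup>2) ^ m / fact m * rGamma (\<nu> + real m + 1))" for m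
  proof -
    have "(-1) ^ m * (2 * s / 2) powr (\<nu> + 2 * real m)
        / (Gamma (real m + 1) * Gamma (\<nu> + real m + 1))
      = (-1) ^ m * (s powr (\<nu> + 2 * real m) / (Gamma (real m + 1) * Gamma (\<nu> + real m + 1)))"
      by simp
    also have "\<dots> = s powr \<nu> * ((- s\<^sup>2) ^ m / fact m * rGamma (\<nu> + real m + 1))"
      unfolding bessel_term[OF assms] power_minus[of "s\<^sup>2" m] by simp
    finally show ?thesis .
  qed
  then show ?thesis
    unfolding bessel_J_def bessel_series_def
    by (subst suminf_mult[symmetric, OF summable_bessel_series]) simp
qed

section \<open>Fibonacci and Lucas polynomials\<close>

lemma fib_poly_minus: "fib_poly (- n) = (if even n then - fib_poly n else fib_poly n)"
proof -
  consider "n = 0" | "n > 0" | "n < 0" by linarith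
  then show ?thesis
    by cases (auto simp: fib_poly_def even_nat_iff minus_one_power_iff)
qed

lemma fib_poly_nat_ge_1: "x \<ge> 1 \<Longrightarrow> n > 0 \<Longrightarrow> poly (fib_poly_nat n) x \<ge> 1"
proof (induction n rule: fib_poly_nat.induct)
  case (3 n)
  have "1 * 1 \<le> x * poly (fib_poly_nat (Suc n)) x"
    using 3 by (intro mult_mono) auto
  moreover have "poly (fib_poly_nat n) x \<ge> 0"
    using 3 by (cases n) auto
  ultimately show ?case by simp
qed auto

text \<open>Inserted into \<sigma>, this makes the terms with \<alpha> cancel, leaving the
  coefficient that occurs where two blocks meet.\<close>

lemma lucas_poly_eq: "lucas_poly (Suc n) = [:0, 1:] * fib_poly_nat (Suc n) + 2 * fib_poly_nat n"
  by (induction n rule: fib_poly_nat.induct) (simp_all add: algebra_simps numeral_2_eq_2)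

section \<open>Solutions of the recurrence built from blocks\<close>

text \<open>The tail recurrence solved for its last term, so that it holds by construction and only
  the block shape of the solution remains to be shown.\<close>

fun unfold_rec :: "(nat \<Rightarrow> nat) \<Rightarrow> real \<Rightarrow> real \<Rightarrow> nat \<Rightarrow> real" where
  "unfold_rec a u v 0 = u"
| "unfold_rec a u v (Suc 0) = v"
| "unfold_rec a u v (Suc (Suc n)) = unfold_rec a u v n - real (a n) * unfold_rec a u v (Suc n)"

lemma unfold_rec_solves:
  "unfold_rec a u v n
    = real (a n) * unfold_rec a u v (Suc n) + unfold_rec a u v (Suc (Suc n))"
  by simp

text \<open>Within a block of constant quotients the tail sequence is a Fibonacci combination of two
  consecutive Bessel values. Thanks to negative Fibonacci indices, the initial segment of length
  \<open>r\<close> is the end of a block, truncated or continued backwards.\<close>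

definition block :: "(int \<Rightarrow> real) \<Rightarrow> nat \<Rightarrow> (nat \<Rightarrow> real) \<Rightarrow> nat \<Rightarrow> int \<Rightarrow> real" where
  "block F d B j i = F (int d + 1 - i) * B j + (-1) ^ (d + 1) * F (1 - i) * B (Suc j)"

lemma block_rec:
  assumes "\<And>n. F n = x * F (n - 1) + F (n - 2)"
  shows "block F d B j i = x * block F d B j (i + 1) + block F d B j (i + 2)"
  unfolding block_def using assms[of "int d + 1 - i"] assms[of "1 - i"]
  by (simp add: algebra_simps)

lemma xi_quot_block:
  assumes "1 \<le> i" "i < d"
  shows "xi_quot \<alpha> \<beta>0 \<beta>1 d r (r + j * d + i) = \<alpha>"
proof -
  have "\<not> d dvd i" using assms by (simp add: nat_dvd_not_less)
  then have "\<not> d dvd (j * d + i)" by (simp add: dvd_add_right_iff)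
  then show ?thesis by (simp add: xi_quot_def add.assoc)
qed

text \<open>Two consecutive values determine the rest, so each induction tracks a pair. Inside a
  block \<open>block_rec\<close> suffices; the hypothesis on \<open>B\<close> is precisely the
  condition for passing a quotient \<beta>0 + \<beta>1 j from block \<open>j\<close> to block
  \<open>Suc j\<close>.\<close>

lemma blocks:
  fixes y :: "nat \<Rightarrow> real" and F :: "int \<Rightarrow> real"
  assumes d: "d > 0"
    and rec: "\<And>n. F n = real \<alpha> * F (n - 1) + F (n - 2)" and F0: "F 0 = 0" "F 1 = 1"
    and neg: "\<And>n. F (- n) = (if even n then - F n else F n)"
    and B: "\<And>j. B j = (F (int d) * (real \<beta>0 + real \<beta>1 * real j) + 2 * F (int d - 1)) * B (Suc j)
                        + (-1) ^ (d + 1) * B (Suc (Suc j))"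
    and y: "\<And>n. y n = real (xi_quot \<alpha> \<beta>0 \<beta>1 d r n) * y (Suc n) + y (Suc (Suc n))"
    and y0: "y 0 = block F d B 0 (int d - int r)" "y 1 = block F d B 0 (int d - int r + 1)"
  shows "y (r + j * d) = block F d B j (int d) \<and> y (r + j * d + 1) = block F d B j (int d + 1)"
    and "1 \<le> i \<Longrightarrow> i \<le> d \<Longrightarrow> y (r + j * d + i) = block F d B (Suc j) (int i)"
proof -
  let ?Z = "block F d B"
  note Zrec = block_rec[OF rec]
  have prefix: "n \<le> r \<Longrightarrow> y n = ?Z 0 (int d - int r + int n)
      \<and> y (Suc n) = ?Z 0 (int d - int r + int n + 1)" for n
  proof (induction n)
    case 0
    then show ?case using y0 by simp
  next
    case (Suc n)
    then have "y n = real \<alpha> * y (Suc n) + y (Suc (Suc n))"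
      using y[of n] by (simp add: xi_quot_def)
    moreover have "y n = ?Z 0 (int d - int r + int n)" "y (Suc n) = ?Z 0 (int d - int r + int n + 1)"
      using Suc by simp_all
    ultimately show ?case
      using Zrec[of d B 0 "int d - int r + int n"] by (simp add: add.assoc add.commute)
  qed
  have inner: "y (r + j * d + i) = ?Z (Suc j) (int i) \<and> y (r + j * d + Suc i) = ?Z (Suc j) (int i + 1)"
    if start: "y (r + j * d) = ?Z j (int d)" "y (r + j * d + 1) = ?Z j (int d + 1)"
      and "1 \<le> i" "i \<le> d" for i j
    using \<open>1 \<le> i\<close> \<open>i \<le> d\<close>
  proof (induction i rule: dec_induct)
    case base
    have Fd: "F (- int d) = (-1) ^ (d + 1) * F (int d)"
      using neg[of "int d"] by simp
    have Fd1: "F (1 - int d) = (-1) ^ d * F (int d - 1)"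
      using neg[of "int d - 1"] by simp
    have Fm1: "F (-1) = 1" using neg[of 1] F0 by simp
    have e: "(-1) ^ d * ((-1) ^ d * x) = (x::real)" for x
      by (simp add: flip: mult.assoc power_add mult_2)
    \<comment> \<open>The blocks overlap: position \<open>d + 1\<close> of block \<open>j\<close>
      and position 1 of the next both equal \<open>F d * B (Suc j)\<close>, by reflection of
      \<open>F (- d)\<close>.\<close>
    have 1: "y (r + j * d + 1) = ?Z (Suc j) 1"
      using start(2) F0 by (simp add: block_def Fd e mult.assoc)
    have "y (r + j * d + 2)
        = ?Z j (int d) - (real \<beta>0 + real \<beta>1 * real j) * ?Z j (int d + 1)"
      using y[of "r + j * d"] start d by (simp add: xi_quot_def)
    also have "\<dots> = ?Z (Suc j) 2"
      using B[of j] F0 by (simp add: block_def Fd Fd1 Fm1 e mult.assoc) (simp add: algebra_simps)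
    finally show ?case using 1 by simp
  next
    case (step i)
    have "y (r + j * d + i) = real \<alpha> * y (r + j * d + Suc i) + y (r + j * d + Suc (Suc i))"
      using y[of "r + j * d + i"] xi_quot_block[of i d \<alpha> \<beta>0 \<beta>1 r j] step by simp
    with step Zrec[of d B "Suc j" "int i"] show ?case
      by (simp add: algebra_simps)
  qed
  have outer: "y (r + j * d) = ?Z j (int d) \<and> y (r + j * d + 1) = ?Z j (int d + 1)" for j
  proof (induction j)
    case 0
    then show ?case using prefix[of r] by simp
  next
    case (Suc j)
    with inner[of j d] d show ?case by (simp add: algebra_simps)
  qed
  show "y (r + j * d) = ?Z j (int d) \<and> y (r + j * d + 1) = ?Z j (int d + 1)"
    by (rule outer)
  show "1 \<le> i \<Longrightarrow> i \<le> d \<Longrightarrow> y (r + j * d + i) = ?Z (Suc j) (int i)"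
    using inner outer by blast
qed

lemma xi_quot_tendsto:
  fixes \<alpha> \<beta>0 \<beta>1 d r :: nat and F :: "int \<Rightarrow> real" and B :: "nat \<Rightarrow> real"
  assumes pos: "\<alpha> > 0" "\<beta>0 > 0" "d > 0"
    and rec: "\<And>n. F n = real \<alpha> * F (n - 1) + F (n - 2)" and F0: "F 0 = 0" "F 1 = 1"
    and neg: "\<And>n. F (- n) = (if even n then - F n else F n)" and Fd: "F (int d) > 0"
    and B: "\<And>j. B j = (F (int d) * (real \<beta>0 + real \<beta>1 * real j) + 2 * F (int d - 1)) * B (Suc j)
                        + (-1) ^ (d + 1) * B (Suc (Suc j))"
    and bd: "\<And>j. \<bar>B (Suc j)\<bar> \<le> M" and nz: "B (Suc k) \<noteq> 0"
  shows "finite_cfrac (xi_quot \<alpha> \<beta>0 \<beta>1 d r) \<longlonglongrightarrow>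
    (F (int r + 1) * B 0 + (-1) ^ (r + 1) * F (int d - int r - 1) * B 1)
      / (F (int r) * B 0 + (-1) ^ r * F (int d - int r) * B 1)"
proof -
  define y where "y = unfold_rec (xi_quot \<alpha> \<beta>0 \<beta>1 d r)
    (block F d B 0 (int d - int r)) (block F d B 0 (int d - int r + 1))"
  have y: "y n = real (xi_quot \<alpha> \<beta>0 \<beta>1 d r n) * y (Suc n) + y (Suc (Suc n))" for n
    unfolding y_def by (rule unfold_rec_solves)
  have y0: "y 0 = block F d B 0 (int d - int r)" "y 1 = block F d B 0 (int d - int r + 1)"
    by (simp_all add: y_def)
  note bl = blocks[OF pos(3) rec F0 neg B y y0]
  \<comment> \<open>For \<open>i\<close> from 1 to \<open>d\<close>, the indices
    \<open>d + 1 - i\<close> and \<open>1 - i\<close> in \<open>block\<close> stay in this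
    range.\<close>
  define C where "C = (\<Sum>k\<in>{1 - int d..int d}. \<bar>F k\<bar>)"
  have C: "\<bar>F k\<bar> \<le> C" if "k \<in> {1 - int d..int d}" for k
    unfolding C_def using that by (intro member_le_sum) auto
  have "finite_cfrac (xi_quot \<alpha> \<beta>0 \<beta>1 d r) \<longlonglongrightarrow> y 0 / y 1"
  proof (rule finite_cfrac_tendsto[where y = y and N = r])
    show "1 \<le> xi_quot \<alpha> \<beta>0 \<beta>1 d r i" for i
      using pos by (simp add: xi_quot_def)
  next
    show "y n = real (xi_quot \<alpha> \<beta>0 \<beta>1 d r n) * y (Suc n) + y (Suc (Suc n))" for n
      by (rule y)
  next
    fix n assume n: "n > r"
    \<comment> \<open>The shift by 1 before dividing puts \<open>i\<close> in the range from 1 to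
      \<open>d\<close>, as positions in a block are counted.\<close>
    define j i where "j = (n - r - 1) div d" and "i = (n - r - 1) mod d + 1"
    have i: "1 \<le> i" "i \<le> d"
      using pos(3) by (simp_all add: i_def Suc_le_eq)
    have "n = r + j * d + i"
      using n by (simp add: i_def j_def)
    then have "\<bar>y n\<bar> = \<bar>F (int d + 1 - int i) * B (Suc j)
        + (-1) ^ (d + 1) * F (1 - int i) * B (Suc (Suc j))\<bar>"
      using bl(2)[OF i] by (simp add: block_def)
    also have "\<dots> \<le> \<bar>F (int d + 1 - int i)\<bar> * \<bar>B (Suc j)\<bar> + \<bar>F (1 - int i)\<bar> * \<bar>B (Suc (Suc j))\<bar>"
      by (rule order_trans[OF abs_triangle_ineq]) (simp add: abs_mult power_abs)
    also have "\<dots> \<le> C * M + C * M"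
      by (intro add_mono mult_mono C bd order_trans[OF abs_ge_zero C]) (use i in auto)
    finally show "\<bar>y n\<bar> \<le> C * M + C * M" .
  next
    have "y (r + k * d + 1) = F (int d) * B (Suc k)"
      using bl(2)[of 1 k] pos F0 by (simp add: block_def)
    with nz Fd show "y (r + k * d + 1) \<noteq> 0" by simp
  qed
  \<comment> \<open>Position \<open>d - r\<close> of block 0 carries
    \<open>(-1) ^ (d + 1) * F (1 - d + r)\<close>; reflecting the index leaves the sign
    \<open>(-1) ^ (r + 1)\<close>.\<close>
  moreover have "y 0 = F (int r + 1) * B 0 + (-1) ^ (r + 1) * F (int d - int r - 1) * B 1"
    using neg[of "int d - int r - 1"] unfolding y0 block_def
    by (auto simp: minus_one_power_iff algebra_simps)
  moreover have "y 1 = F (int r) * B 0 + (-1) ^ r * F (int d - int r) * B 1"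
    using neg[of "int d - int r"] unfolding y0 block_def
    by (auto simp: minus_one_power_iff algebra_simps)
  ultimately show ?thesis by simp
qed

section \<open>Bessel values as block coefficients\<close>

theorem theorem2p9:
  fixes \<alpha> \<beta>0 \<beta>1 d r :: nat and \<sigma> \<rho> :: real and F :: "int \<Rightarrow> real"
  assumes "\<alpha> > 0" and "\<beta>0 > 0" and "\<beta>1 > 0" and "d > 0"
    and F: "\<And>n. F n = poly (fib_poly n) (real \<alpha>)"
    and \<sigma>: "\<sigma> = (real \<beta>0 - real \<alpha>) / real \<beta>1
                + poly (lucas_poly d) (real \<alpha>) / (real \<beta>1 * F (int d))"
    and \<rho>: "\<rho> = (-1) ^ (d - 1) / ((real \<beta>1)\<^sup>2 * (F (int d))\<^sup>2)"
  shows "convergent (finite_cfrac (xi_quot \<alpha> \<beta>0 \<beta>1 d r)) \<and>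
    (odd d \<longrightarrow> xi \<alpha> \<beta>0 \<beta>1 d r =
      (F (int r + 1) * bessel_I (\<sigma> - 1) (2 * sqrt \<rho>)
         + (-1) ^ (r + 1) * F (int d - int r - 1) * bessel_I \<sigma> (2 * sqrt \<rho>))
      / (F (int r) * bessel_I (\<sigma> - 1) (2 * sqrt \<rho>)
         + (-1) ^ r * F (int d - int r) * bessel_I \<sigma> (2 * sqrt \<rho>))) \<and>
    (even d \<longrightarrow> xi \<alpha> \<beta>0 \<beta>1 d r =
      (F (int r + 1) * bessel_J (\<sigma> - 1) (2 * sqrt (- \<rho>))
         + (-1) ^ (r + 1) * F (int d - int r - 1) * bessel_J \<sigma> (2 * sqrt (- \<rho>)))
      / (F (int r) * bessel_J (\<sigma> - 1) (2 * sqrt (- \<rho>))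
         + (-1) ^ r * F (int d - int r) * bessel_J \<sigma> (2 * sqrt (- \<rho>))))"
proof -
  have rec: "F n = real \<alpha> * F (n - 1) + F (n - 2)" for n
    unfolding F by (subst fib_poly_rec) simp
  have F0: "F 0 = 0" "F 1 = 1" by (simp_all add: F fib_poly_def)
  have neg: "F (- n) = (if even n then - F n else F n)" for n
    by (simp add: F fib_poly_minus)
  have Fd: "F (int d) \<ge> 1"
    using assms by (simp add: F fib_poly_def fib_poly_nat_ge_1)
  have Fd1: "F (int d - 1) \<ge> 0"
    using \<open>d > 0\<close> \<open>\<alpha> > 0\<close> fib_poly_nat_ge_1[of "real \<alpha>" "d - 1"]
    by (cases "d = 1") (auto simp: F fib_poly_def nat_diff_distrib)
  have L: "poly (lucas_poly d) (real \<alpha>) = real \<alpha> * F (int d) + 2 * F (int d - 1)"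
    using lucas_poly_eq[of "d - 1"] \<open>d > 0\<close> by (simp add: F fib_poly_def nat_diff_distrib)
  have \<sigma>': "\<sigma> * (real \<beta>1 * F (int d)) = F (int d) * real \<beta>0 + 2 * F (int d - 1)"
    using \<open>\<beta>1 > 0\<close> Fd unfolding \<sigma> L by (simp add: field_simps)
  have "\<sigma> * (real \<beta>1 * F (int d)) > 0"
    unfolding \<sigma>' using Fd Fd1 \<open>\<beta>0 > 0\<close> by (simp add: add_pos_nonneg)
  then have \<sigma>_pos: "\<sigma> > 0"
    by (rule zero_less_mult_pos2) (use Fd \<open>\<beta>1 > 0\<close> in simp)
  \<comment> \<open>\<open>s\<close> is the square root of \<bar>\<rho>\<bar>, half the Bessel
    argument, and \<epsilon> is the sign of \<rho>: positive exactly for odd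
    \<open>d\<close>.\<close>
  define s where "s = 1 / (real \<beta>1 * F (int d))"
  define \<epsilon> :: real where "\<epsilon> = (-1) ^ (d + 1)"
  have s: "s > 0" "s \<le> 1"
    using Fd \<open>\<beta>1 > 0\<close> mult_mono[of 1 "real \<beta>1" 1 "F (int d)"] by (simp_all add: s_def)
  have \<rho>': "\<rho> = \<epsilon> * s\<^sup>2"
    using \<open>d > 0\<close> unfolding \<rho> \<epsilon>_def s_def by (cases d) (auto simp: power_divide power_mult_distrib)
  \<comment> \<open>\<open>B j\<close> is the value at \<open>2 * s\<close> of the Bessel function
    of order \<sigma> - 1 + j, of type I for odd \<open>d\<close> and J for even
    \<open>d\<close>.\<close>
  define B where "B = (\<lambda>j. s powr (\<sigma> - 1 + real j) * bessel_series (\<sigma> - 1 + real j) \<rho>)"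
  have lim: "finite_cfrac (xi_quot \<alpha> \<beta>0 \<beta>1 d r) \<longlonglongrightarrow>
    (F (int r + 1) * B 0 + (-1) ^ (r + 1) * F (int d - int r - 1) * B 1)
      / (F (int r) * B 0 + (-1) ^ r * F (int d - int r) * B 1)"
  proof (rule xi_quot_tendsto[OF \<open>\<alpha> > 0\<close> \<open>\<beta>0 > 0\<close> \<open>d > 0\<close> rec F0 neg])
    show "F (int d) > 0" using Fd by simp
  next
    fix j
    define \<nu> where "\<nu> = \<sigma> + real j"
    have "B j = s powr (\<nu> - 1) * (\<nu> * bessel_series \<nu> \<rho> + \<epsilon> * s\<^sup>2 * bessel_series (\<nu> + 1) \<rho>)"
      unfolding \<rho>'[symmetric] bessel_series_rec[symmetric] by (simp add: B_def \<nu>_def algebra_simps)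
    also have "\<dots> = \<nu> / s * (s powr \<nu> * bessel_series \<nu> \<rho>)
        + \<epsilon> * (s powr (\<nu> + 1) * bessel_series (\<nu> + 1) \<rho>)"
      using s by (simp add: powr_diff powr_add field_simps power2_eq_square)
    also have "\<dots> = \<nu> / s * B (Suc j) + \<epsilon> * B (Suc (Suc j))"
      by (simp add: B_def \<nu>_def algebra_simps)
    \<comment> \<open>This identity explains the choice of \<sigma>: dividing by \<open>s\<close>
      multiplies by \<beta>1 \<open>F d\<close>, which clears its denominators.\<close>
    also have "\<nu> / s = F (int d) * (real \<beta>0 + real \<beta>1 * real j) + 2 * F (int d - 1)"
      using \<sigma>' by (simp add: \<nu>_def s_def algebra_simps)
    finally show "B j = (F (int d) * (real \<beta>0 + real \<beta>1 * real j) + 2 * F (int d - 1)) * B (Suc j)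
        + (-1) ^ (d + 1) * B (Suc (Suc j))"
      by (simp add: \<epsilon>_def)
  next
    fix j
    \<comment> \<open>The bound starts at \<open>B 1\<close>, whose order \<sigma> is positive; the
      order of \<open>B 0\<close> may be negative.\<close>
    have "s powr (\<sigma> + real j) \<le> 1"
      using s \<sigma>_pos by (intro powr_le1) auto
    then have "\<bar>B (Suc j)\<bar> \<le> 1 * bessel_series \<sigma> \<bar>\<rho>\<bar>"
      using abs_bessel_series_le[of \<sigma> j \<rho>] \<sigma>_pos unfolding B_def abs_mult
      by (intro mult_mono) auto
    then show "\<bar>B (Suc j)\<bar> \<le> bessel_series \<sigma> \<bar>\<rho>\<bar>" by simp
  next
    \<comment> \<open>This index lifts the order above the threshold of
      \<open>bessel_series_nonzero\<close>.\<close>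
    have "\<sigma> + real (nat \<lceil>exp \<bar>\<rho>\<bar>\<rceil>) \<ge> exp \<bar>\<rho>\<bar>"
      using \<sigma>_pos real_nat_ceiling_ge[of "exp \<bar>\<rho>\<bar>"] by linarith
    from bessel_series_nonzero[OF this] s show "B (Suc (nat \<lceil>exp \<bar>\<rho>\<bar>\<rceil>)) \<noteq> 0"
      by (simp add: B_def)
  qed
  then have "convergent (finite_cfrac (xi_quot \<alpha> \<beta>0 \<beta>1 d r))"
    and xi: "xi \<alpha> \<beta>0 \<beta>1 d r =
      (F (int r + 1) * B 0 + (-1) ^ (r + 1) * F (int d - int r - 1) * B 1)
      / (F (int r) * B 0 + (-1) ^ r * F (int d - int r) * B 1)"
    unfolding xi_def by (auto intro: convergentI limI)
  moreover have "bessel_I (\<sigma> - 1) (2 * sqrt \<rho>) = B 0" "bessel_I \<sigma> (2 * sqrt \<rho>) = B 1" if "odd d"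
    using that s by (simp_all add: \<rho>' \<epsilon>_def B_def bessel_I_eq)
  moreover have "bessel_J (\<sigma> - 1) (2 * sqrt (- \<rho>)) = B 0" "bessel_J \<sigma> (2 * sqrt (- \<rho>)) = B 1"
    if "even d"
    using that s by (simp_all add: \<rho>' \<epsilon>_def B_def bessel_J_eq)
  ultimately show ?thesis by simp
qed

end
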